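(* Let $n \geq 5$ be an integer and let $\Gamma = KG(n,2)$ be the Kneser graph on the $2$-subsets of an $n$-element set. Then the critical group $K(\Gamma)$ of $\Gamma$ satisfies \[ K(\Gamma) \cong \mathbf{Z}_{n-4} \oplus \left( \mathbf{Z}_{\frac{(n-4)(n-1)}{2}} \right)^{\frac{n(n-5)}{2}} \oplus \mathbf{Z}_{\frac{(n-4)(n-1)(n-3)}{4}} \oplus \left( \mathbf{Z}_{\frac{(n-4)(n-1)(n-3)n}{4}} \right)^{n-2} \quad \text{if $n$ is odd,} \] and \[ K(\Gamma) \cong \mathbf{Z}_{\frac{n-4}{2}} \oplus \left( \mathbf{Z}_{\frac{(n-4)(n-1)}{2}} \right)^{\frac{n(n-5)}{2}} \oplus \mathbf{Z}_{\frac{(n-4)(n-1)(n-3)}{2}} \oplus \left( \mathbf{Z}_{\frac{(n-4)(n-1)(n-3)n}{4}} \right)^{n-2} \quad \text{if $n$ is even.} \]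
   Context: For a positive integer $m$, $\mathbf{Z}_m$ denotes the cyclic group $\mathbb{Z}/m\mathbb{Z}$, and for a group $G$ and an integer $k \geq 0$, $G^k$ denotes the direct sum of $k$ copies of $G$ (trivial when $k=0$). The Kneser graph $KG(n,2)$ is the simple graph whose vertices are the $2$-element subsets of an $n$-element set, two vertices being adjacent if and only if the corresponding subsets are disjoint. For a finite graph $\Gamma$ with vertex set $V(\Gamma)$, let $A$ be its adjacency matrix and $D$ the diagonal matrix whose diagonal entries are the vertex degrees. The Laplacian matrix is $L = D - A$, viewed as a homomorphism of free abelian groups $L \colon \mathbb{Z}^{V(\Gamma)} \to \mathbb{Z}^{V(\Gamma)}$. The critical group $K(\Gamma)$ is the torsion subgroup of the cokernel $\mathbb{Z}^{V(\Gamma)} / \operatorname{Im}(L)$. *)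

theory Defs
  imports "HOL-Algebra.Product_Groups" "Graph_Theory.Pair_Digraph"
begin

text \<open>Simple graphs are represented, as in the Graph_Theory library, by symmetric
  loop-free pair digraphs: each edge contributes the two arcs joining its end points.\<close>

definition kneser_graph :: "'a set \<Rightarrow> nat \<Rightarrow> 'a set pair_pre_digraph" where
  "kneser_graph S k =
     \<lparr>pverts = {A. A \<subseteq> S \<and> card A = k},
      parcs = {(A, B). A \<subseteq> S \<and> card A = k \<and> B \<subseteq> S \<and> card B = k \<and> A \<inter> B = {}}\<rparr>"

definition adjacency_matrix :: "'v pair_pre_digraph \<Rightarrow> 'v \<Rightarrow> 'v \<Rightarrow> int" where
  "adjacency_matrix G u v = (if (u, v) \<in> parcs G then 1 else 0)"

text \<open>In a symmetric digraph the degree of a vertex is its out-degree.\<close>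

definition degree_matrix :: "'v pair_pre_digraph \<Rightarrow> 'v \<Rightarrow> 'v \<Rightarrow> int" where
  "degree_matrix G u v = (if u = v then int (out_degree (with_proj G) u) else 0)"

definition laplacian_matrix :: "'v pair_pre_digraph \<Rightarrow> 'v \<Rightarrow> 'v \<Rightarrow> int" where
  "laplacian_matrix G u v = degree_matrix G u v - adjacency_matrix G u v"

text \<open>For finite \<open>V\<close> the full product below is the free abelian group on \<open>V\<close>; its elements
  are the integer functions on \<open>V\<close>, extended by \<open>undefined\<close> outside \<open>V\<close>.\<close>

definition int_vectors :: "'v set \<Rightarrow> ('v \<Rightarrow> int) monoid" where
  "int_vectors V = product_group V (\<lambda>_. integer_group)"

definition laplacian_map :: "'v pair_pre_digraph \<Rightarrow> ('v \<Rightarrow> int) \<Rightarrow> ('v \<Rightarrow> int)" where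
  "laplacian_map G x = (\<lambda>u\<in>pverts G. \<Sum>v\<in>pverts G. laplacian_matrix G u v * x v)"

definition laplacian_cokernel :: "'v pair_pre_digraph \<Rightarrow> ('v \<Rightarrow> int) set monoid" where
  "laplacian_cokernel G =
     int_vectors (pverts G) Mod (laplacian_map G ` carrier (int_vectors (pverts G)))"

definition torsion_elements :: "('a, 'b) monoid_scheme \<Rightarrow> 'a set" where
  "torsion_elements H = {x \<in> carrier H. \<exists>m::nat. 0 < m \<and> x [^]\<^bsub>H\<^esub> m = \<one>\<^bsub>H\<^esub>}"

definition critical_group :: "'v pair_pre_digraph \<Rightarrow> ('v \<Rightarrow> int) set monoid" where
  "critical_group G =
     (laplacian_cokernel G)\<lparr>carrier := torsion_elements (laplacian_cokernel G)\<rparr>"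

definition direct_power :: "('a, 'b) monoid_scheme \<Rightarrow> nat \<Rightarrow> (nat \<Rightarrow> 'a) monoid" where
  "direct_power H k = sum_group {..<k} (\<lambda>_. H)"

lemma pair_graph_kneser_graph:
  assumes "finite S" and "0 < k"
  shows "pair_graph (kneser_graph S k)"
proof -
  have "parcs (kneser_graph S k) \<subseteq> Pow S \<times> Pow S" "pverts (kneser_graph S k) \<subseteq> Pow S"
    by (auto simp: kneser_graph_def)
  then have fin: "finite (parcs (kneser_graph S k))" "finite (pverts (kneser_graph S k))"
    using assms(1) by (simp_all add: finite_subset[of _ "Pow S \<times> Pow S"] finite_subset[of _ "Pow S"])
  have "arcs_ends (with_proj (kneser_graph S k)) = parcs (kneser_graph S k)"
    by (auto simp: arcs_ends_def arc_to_ends_def image_def)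
  then have "symmetric (with_proj (kneser_graph S k))"
    by (auto simp: symmetric_def sym_def kneser_graph_def)
  moreover have "fst e \<in> pverts (kneser_graph S k) \<and> snd e \<in> pverts (kneser_graph S k) \<and>
      fst e \<noteq> snd e" if "e \<in> parcs (kneser_graph S k)" for e
  proof -
    obtain A B where e: "e = (A, B)" by (cases e)
    with that have "A \<subseteq> S" "card A = k" "B \<subseteq> S" "card B = k" "A \<inter> B = {}"
      by (simp_all add: kneser_graph_def)
    moreover from this have "A \<noteq> B" using assms(2) by (metis Int_absorb card.empty less_numeral_extra(3))
    ultimately show ?thesis by (simp add: e kneser_graph_def)
  qed
  ultimately show ?thesis
    using fin
    by (simp add: pair_graph_def pair_digraph_def pair_pseudo_graph_def pair_fin_digraph_def
        pair_fin_digraph_axioms_def pair_wf_digraph_def pair_loopfree_digraph_def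
        pair_loopfree_digraph_axioms_def pair_sym_digraph_def pair_sym_digraph_axioms_def)
qed

lemma comm_group_int_vectors: "comm_group (int_vectors V)"
proof (rule group.group_comm_groupI)
  show "group (int_vectors V)" by (simp add: int_vectors_def)
  show "x \<otimes>\<^bsub>int_vectors V\<^esub> y = y \<otimes>\<^bsub>int_vectors V\<^esub> x" for x y
    by (simp add: int_vectors_def add.commute)
qed

lemma laplacian_map_hom:
  "laplacian_map G \<in> hom (int_vectors (pverts G)) (int_vectors (pverts G))"
  by (auto simp: hom_def laplacian_map_def int_vectors_def integer_group_def fun_eq_iff
      distrib_left sum.distrib)

lemma subgroup_laplacian_image:
  "subgroup (laplacian_map G ` carrier (int_vectors (pverts G))) (int_vectors (pverts G))"
proof -
  interpret comm_group "int_vectors (pverts G)" by (rule comm_group_int_vectors)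
  have "group_hom (int_vectors (pverts G)) (int_vectors (pverts G)) (laplacian_map G)"
    by (intro group_hom.intro group_hom_axioms.intro laplacian_map_hom is_group)
  then show ?thesis by (rule group_hom.img_is_subgroup)
qed

lemma comm_group_laplacian_cokernel: "comm_group (laplacian_cokernel G)"
  unfolding laplacian_cokernel_def
  using comm_group_int_vectors subgroup_laplacian_image
  by (rule comm_group.abelian_FactGroup)

lemma (in comm_group) subgroup_torsion_elements: "subgroup (torsion_elements G) G"
proof (rule subgroupI)
  show "torsion_elements G \<subseteq> carrier G" by (auto simp: torsion_elements_def)
  have "\<one> [^] (1::nat) = \<one>" by (rule nat_pow_one)
  then have "\<one> \<in> torsion_elements G"
    unfolding torsion_elements_def by (blast intro: zero_less_one)
  then show "torsion_elements G \<noteq> {}" by blast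
next
  fix a assume "a \<in> torsion_elements G"
  then obtain m :: nat where m: "a \<in> carrier G" "0 < m" "a [^] m = \<one>"
    by (auto simp: torsion_elements_def)
  then have "inv a [^] m = \<one>" by (simp add: nat_pow_inv)
  with m show "inv a \<in> torsion_elements G"
    by (auto simp: torsion_elements_def)
next
  fix a b assume "a \<in> torsion_elements G" "b \<in> torsion_elements G"
  then obtain m k :: nat where
      m: "a \<in> carrier G" "0 < m" "a [^] m = \<one>" and k: "b \<in> carrier G" "0 < k" "b [^] k = \<one>"
    by (auto simp: torsion_elements_def)
  have "a [^] (m * k) = \<one>"
    using m by (simp flip: nat_pow_pow)
  moreover have "b [^] (m * k) = \<one>"
    using k by (simp add: mult.commute[of m] flip: nat_pow_pow)
  ultimately have "(a \<otimes> b) [^] (m * k) = \<one>"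
    using m k by (simp add: nat_pow_distrib)
  moreover have "0 < m * k" using m k by simp
  ultimately show "a \<otimes> b \<in> torsion_elements G"
    using m k unfolding torsion_elements_def by blast
qed

lemma comm_group_critical_group: "comm_group (critical_group G)"
proof -
  interpret comm_group "laplacian_cokernel G" by (rule comm_group_laplacian_cokernel)
  have "group (critical_group G)"
    unfolding critical_group_def
    using subgroup_torsion_elements is_group by (rule subgroup.subgroup_is_group)
  then show ?thesis
    by (rule group.group_comm_groupI)
       (auto simp: critical_group_def torsion_elements_def m_comm)
qed

end

theory Submission
  imports Defs "HOL-Algebra.Multiplicative_Group"
begin

text \<open>
  Write \<open>y\<^sub>i\<close> for the sum of an edge vector \<open>x\<close> over the edges of the complete graph at \<open>i\<close>, and
  \<open>t\<close> for the sum of all its entries. Since two edges are disjoint unless they share an end,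
  \<open>(L x)\<^sub>i\<^sub>j = c x\<^sub>i\<^sub>j + y\<^sub>i + y\<^sub>j - t\<close> with \<open>c = (n-1)(n-4)/2\<close>. Consequently \<open>L\<close> sends \<open>y\<^sub>i\<close> to
  \<open>h y\<^sub>i - (n-3) t\<close> and \<open>t\<close> to \<open>0\<close>, where \<open>h = n(n-3)/2\<close>. Fix vertices \<open>p, q, a, d, e\<close>.
  The star at \<open>p\<close> together with \<open>ad\<close> is a spanning subgraph whose entries can be traded for
  \<open>t\<close> and the \<open>y\<^sub>i\<close> with \<open>i \<noteq> p\<close>. On the remaining edges, the star at \<open>q\<close> together with \<open>ae\<close>
  is in turn traded for the parameters \<open>\<omega>\<^sub>i, \<rho>\<close> of the vectors \<open>\<omega>\<^sub>i + \<omega>\<^sub>j - \<rho>\<close>, which are the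
  directions in which \<open>y\<^sub>i + y\<^sub>j - t\<close> moves the entries. What is left of the other entries is
  \<open>\<zeta>\<close>. In this integral basis \<open>L\<close> is triangular: \<open>\<zeta>\<close> is multiplied by \<open>c\<close>,
  \<open>y\<^sub>i - y\<^sub>q - h \<omega>\<^sub>i\<close> becomes a free multiple of \<open>h c\<close>, and \<open>y\<^sub>q + (n-3) \<rho>\<close> a free multiple of
  \<open>b = (n-3)(n-4)/2\<close>. Hence the critical group is a sum of cyclic groups of orders \<open>c\<close>,
  \<open>h c\<close> and (once) \<open>b\<close>; one pair of summands of orders \<open>c\<close> and \<open>b\<close> is replaced by their gcd
  and lcm, and this is where the parity of \<open>n\<close> enters.
\<close>

section \<open>The Laplacian of the Kneser graph of 2-subsets\<close>

definition pairs :: "'a set \<Rightarrow> 'a set set" where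
  "pairs U = {A. A \<subseteq> U \<and> card A = 2}"

text \<open>The \<open>y\<^sub>i\<close> of the overview; \<open>total_sum\<close> is its
  \<open>t\<close>.\<close>

definition star_sum :: "'a set \<Rightarrow> ('a set \<Rightarrow> int) \<Rightarrow> 'a \<Rightarrow> int" where
  "star_sum U x i = (\<Sum>j\<in>U - {i}. x {i, j})"

definition total_sum :: "'a set \<Rightarrow> ('a set \<Rightarrow> int) \<Rightarrow> int" where
  "total_sum U x = (\<Sum>A\<in>pairs U. x A)"

lemma finite_pairs: "finite U \<Longrightarrow> finite (pairs U)"
  by (simp add: pairs_def)

lemma card_pairs: "finite U \<Longrightarrow> card (pairs U) = card U choose 2"
  by (simp add: pairs_def n_subsets)

lemma pairsE:
  assumes "A \<in> pairs U"
  obtains i j where "A = {i, j}" "i \<noteq> j" "i \<in> U" "j \<in> U"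
  using assms by (auto simp: pairs_def card_2_iff)

lemma pair_in_pairs: "{i, j} \<in> pairs U \<longleftrightarrow> i \<noteq> j \<and> i \<in> U \<and> j \<in> U"
  by (auto simp: pairs_def card_insert_if)

lemma pairs_insert: "pairs (insert u U) = pairs U \<union> (\<lambda>j. {u, j}) ` (U - {u})"
proof (intro equalityI subsetI)
  fix A assume "A \<in> pairs (insert u U)"
  then obtain i j where "A = {i, j}" "i \<noteq> j" "i \<in> insert u U" "j \<in> insert u U"
    by (rule pairsE)
  then show "A \<in> pairs U \<union> (\<lambda>j. {u, j}) ` (U - {u})"
    by (auto simp: pair_in_pairs insert_commute)
next
  fix A assume "A \<in> pairs U \<union> (\<lambda>j. {u, j}) ` (U - {u})"
  then show "A \<in> pairs (insert u U)"
    by (auto simp: pair_in_pairs) (auto simp: pairs_def)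
qed

lemma total_sum_insert:
  assumes "finite U" "u \<notin> U"
  shows "total_sum (insert u U) x = total_sum U x + (\<Sum>j\<in>U. x {u, j})"
proof -
  have "inj_on (\<lambda>j. {u, j}) U" by (auto simp: inj_on_def doubleton_eq_iff)
  moreover have "pairs U \<inter> (\<lambda>j. {u, j}) ` U = {}"
    using assms(2) by (auto simp: pairs_def)
  ultimately show ?thesis
    using assms by (simp add: total_sum_def pairs_insert sum.union_disjoint finite_pairs sum.reindex)
qed

lemma star_sum_insert:
  assumes "finite U" "u \<notin> U" "i \<in> U"
  shows "star_sum (insert u U) x i = star_sum U x i + x {u, i}"
proof -
  have "insert u U - {i} = insert u (U - {i})" using assms by auto
  then show ?thesis using assms by (simp add: star_sum_def insert_commute)
qed

text \<open>Each edge is counted once from each of its two ends.\<close>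

lemma sum_star_sum: "finite U \<Longrightarrow> (\<Sum>i\<in>U. star_sum U x i) = 2 * total_sum U x"
proof (induction U rule: finite_induct)
  case empty
  have "pairs {} = ({} :: 'a set set)" by (auto elim: pairsE)
  then show ?case by (simp add: total_sum_def)
next
  case (insert u U)
  then show ?case
    by (simp add: star_sum_insert total_sum_insert sum.distrib)
       (simp add: star_sum_def)
qed

text \<open>Inclusion-exclusion over the stars at \<open>i\<close> and \<open>j\<close>: the edge
  \<open>{i, j}\<close> is the only one in both, so its entry is added back.\<close>

lemma sum_disjoint_pairs:
  assumes "finite U" "i \<in> U" "j \<in> U" "i \<noteq> j"
  shows "(\<Sum>A\<in>{A \<in> pairs U. {i, j} \<inter> A = {}}. x A) =
    total_sum U x - star_sum U x i - star_sum U x j + x {i, j}"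
proof -
  define U' where "U' = U - {i, j}"
  have U': "U = insert i (insert j U')" "i \<notin> insert j U'" "j \<notin> U'" "finite U'"
    using assms by (auto simp: U'_def)
  have "{A \<in> pairs U. {i, j} \<inter> A = {}} = pairs U'"
    by (auto simp: pairs_def U'_def)
  moreover have "insert i (insert j U') - {j} = insert i U'" using assms(4) U' by auto
  moreover have "insert i (insert j U') - {i} = insert j U'" using assms(4) U' by auto
  ultimately show ?thesis
    using U' by (simp add: total_sum_insert star_sum_def insert_commute flip: total_sum_def)
qed

lemma total_sum_cong: "(\<And>A. A \<in> pairs U \<Longrightarrow> x A = y A) \<Longrightarrow> total_sum U x = total_sum U y"
  by (simp add: total_sum_def)

lemma star_sum_cong:
  "(\<And>A. A \<in> pairs U \<Longrightarrow> x A = y A) \<Longrightarrow> i \<in> U \<Longrightarrow> star_sum U x i = star_sum U y i"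
  unfolding star_sum_def by (intro sum.cong refl) (auto simp: pair_in_pairs)

section \<open>The Laplacian as an operator on edge vectors\<close>

lemma pverts_kneser_graph: "pverts (kneser_graph S 2) = pairs S"
  by (simp add: kneser_graph_def pairs_def)

lemma parcs_kneser_graph:
  "(A, B) \<in> parcs (kneser_graph S 2) \<longleftrightarrow> A \<in> pairs S \<and> B \<in> pairs S \<and> A \<inter> B = {}"
  by (auto simp: kneser_graph_def pairs_def)

lemma out_degree_kneser_graph:
  assumes "finite S" "A \<in> pairs S"
  shows "out_degree (with_proj (kneser_graph S 2)) A = (card S - 2) choose 2"
proof -
  have "card A = 2" "A \<subseteq> S" using assms(2) by (auto simp: pairs_def)
  then have fin: "finite A" by (simp add: card_ge_0_finite)
  have "out_arcs (with_proj (kneser_graph S 2)) A = {(A, B) | B. (A, B) \<in> parcs (kneser_graph S 2)}"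
    by (auto simp: out_arcs_def)
  also have "\<dots> = Pair A ` pairs (S - A)"
    unfolding parcs_kneser_graph using assms(2) by (auto simp: pairs_def)
  finally have "out_degree (with_proj (kneser_graph S 2)) A = card (pairs (S - A))"
    by (simp add: out_degree_def card_image inj_on_def)
  then show ?thesis
    using assms \<open>card A = 2\<close> \<open>A \<subseteq> S\<close> fin by (simp add: card_pairs card_Diff_subset)
qed

lemma choose_two_int: "2 * int (k choose 2) = int k * (int k - 1)"
proof -
  have "even (k * (k - 1))" by (cases k) auto
  then have "2 * (k choose 2) = k * (k - 1)" by (simp add: choose_two)
  then have "2 * int (k choose 2) = int (k * (k - 1))" by (metis of_nat_mult of_nat_numeral)
  then show ?thesis by (cases k) (auto simp: algebra_simps)
qed

lemma laplacian_map_kneser_graph: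
  assumes "finite S" "card S \<ge> 2" "2 * c = (int (card S) - 1) * (int (card S) - 4)"
    and "i \<in> S" "j \<in> S" "i \<noteq> j"
  shows "laplacian_map (kneser_graph S 2) x {i, j} =
    c * x {i, j} + star_sum S x i + star_sum S x j - total_sum S x"
proof -
  let ?P = "pairs S" let ?d = "int ((card S - 2) choose 2)"
  have ij: "{i, j} \<in> ?P" using assms by (simp add: pair_in_pairs)
  have "2 * ?d = (int (card S) - 2) * (int (card S) - 3)"
    using assms(2) by (simp add: choose_two_int of_nat_diff)
  \<comment> \<open>The degree exceeds \<open>c\<close> by 1, which cancels the entry of
    \<open>{i, j}\<close> restored by inclusion-exclusion.\<close>
  then have d: "?d = c + 1" using assms(3) by (simp add: algebra_simps)
  have "laplacian_map (kneser_graph S 2) x {i, j} =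
      (\<Sum>A\<in>?P. (if {i, j} = A then ?d * x A else 0) - (if {i, j} \<inter> A = {} then x A else 0))"
    using ij assms(1) unfolding laplacian_map_def
    by (auto simp: pverts_kneser_graph laplacian_matrix_def degree_matrix_def adjacency_matrix_def
        out_degree_kneser_graph parcs_kneser_graph left_diff_distrib intro!: sum.cong)
  also have "\<dots> = ?d * x {i, j} - (\<Sum>A\<in>{A \<in> ?P. {i, j} \<inter> A = {}}. x A)"
    using ij assms(1) by (simp add: sum_subtractf finite_pairs sum.delta' sum.inter_filter)
  also have "\<dots> = (c + 1) * x {i, j} - (total_sum S x - star_sum S x i - star_sum S x j + x {i, j})"
    unfolding d sum_disjoint_pairs[OF assms(1,4-6)] ..
  finally show ?thesis by (simp add: algebra_simps)
qed

section \<open>Trading a star and one further edge for star sums and the total\<close>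

text \<open>Summing the stars over \<open>U\<close> counts edges inside \<open>U\<close> twice and
  edges at \<open>u\<close> once, so subtracting the total leaves the sum over \<open>U\<close>.
  This fixes the entry at \<open>{a, d}\<close>, and then each star fixes the entry at
  \<open>{u, i}\<close>.\<close>

lemma pairs_vector_eqI:
  assumes "finite U" "u \<notin> U" "a \<in> U" "d \<in> U" "a \<noteq> d"
    and pairs: "\<And>A. A \<in> pairs U - {{a, d}} \<Longrightarrow> x A = y A"
    and star: "\<And>i. i \<in> U \<Longrightarrow> star_sum (insert u U) x i = star_sum (insert u U) y i"
    and total: "total_sum (insert u U) x = total_sum (insert u U) y"
    and A: "A \<in> pairs (insert u U)"
  shows "x A = y A"
proof -
  have tot: "total_sum U z = (\<Sum>i\<in>U. star_sum (insert u U) z i) - total_sum (insert u U) z" for z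
    using assms(1,2) by (simp add: star_sum_insert total_sum_insert sum.distrib sum_star_sum)
  have "total_sum U x = total_sum U y" using star total by (simp add: tot)
  moreover have "total_sum U z = z {a, d} + (\<Sum>A\<in>pairs U - {{a, d}}. z A)" for z
    using assms(1,3-5) by (simp add: total_sum_def sum.remove finite_pairs pair_in_pairs)
  moreover have "(\<Sum>A\<in>pairs U - {{a, d}}. x A) = (\<Sum>A\<in>pairs U - {{a, d}}. y A)"
    using pairs by (intro sum.cong) auto
  ultimately have "x {a, d} = y {a, d}" by simp
  with pairs have U: "x A = y A" if "A \<in> pairs U" for A using that by (cases "A = {a, d}") auto
  have "x {u, i} = y {u, i}" if "i \<in> U" for i
    using star[OF that] star_sum_cong[of U x y i] U that assms(1,2) by (simp add: star_sum_insert)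
  with U A assms(2) show ?thesis by (auto simp: pairs_insert)
qed

text \<open>The same elimination run backwards; each unknown enters with coefficient 1, so all
  integer prescriptions are attained.\<close>

lemma pairs_vector_exists:
  fixes z :: "'a set \<Rightarrow> int"
  assumes "finite U" "u \<notin> U" "a \<in> U" "d \<in> U" "a \<noteq> d"
  obtains x where "\<And>A. A \<in> pairs U - {{a, d}} \<Longrightarrow> x A = z A"
    and "\<And>i. i \<in> U \<Longrightarrow> star_sum (insert u U) x i = s i"
    and "total_sum (insert u U) x = t"
proof -
  define z' where "z' = z({a, d} := (\<Sum>i\<in>U. s i) - t - (\<Sum>A\<in>pairs U - {{a, d}}. z A))"
  \<comment> \<open>For an edge at \<open>u\<close>, \<open>the_elem (A - {u})\<close> is its other
    end.\<close>
  define x where "x = (\<lambda>A. if u \<in> A then s (the_elem (A - {u})) - star_sum U z' (the_elem (A - {u})) else z' A)"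
  have xU: "x A = z' A" if "A \<in> pairs U" for A
    using that assms(2) by (auto simp: x_def pairs_def)
  have xu: "x {u, i} = s i - star_sum U z' i" if "i \<in> U" for i
  proof -
    have "{u, i} - {u} = {i}" using that assms(2) by auto
    then show ?thesis by (simp add: x_def)
  qed
  have sU: "star_sum U x i = star_sum U z' i" if "i \<in> U" for i
    using star_sum_cong[OF xU that] .
  have tU: "total_sum U x = total_sum U z'" by (rule total_sum_cong[OF xU])
  show thesis
  proof (rule that[of x])
    show "x A = z A" if "A \<in> pairs U - {{a, d}}" for A
      using that xU[of A] by (auto simp: z'_def)
    show "star_sum (insert u U) x i = s i" if "i \<in> U" for i
      using that assms(1,2) by (simp add: star_sum_insert xu sU)
    have "total_sum U z' = z' {a, d} + (\<Sum>A\<in>pairs U - {{a, d}}. z' A)"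
      using assms(1,3-5) by (simp add: total_sum_def sum.remove finite_pairs pair_in_pairs)
    also have "(\<Sum>A\<in>pairs U - {{a, d}}. z' A) = (\<Sum>A\<in>pairs U - {{a, d}}. z A)"
      by (intro sum.cong) (auto simp: z'_def)
    also have "z' {a, d} = (\<Sum>i\<in>U. s i) - t - (\<Sum>A\<in>pairs U - {{a, d}}. z A)"
      by (simp add: z'_def)
    finally have "total_sum U z' = (\<Sum>i\<in>U. s i) - t" by simp
    then show "total_sum (insert u U) x = t"
      using assms(1,2) by (simp add: total_sum_insert xu tU sum_subtractf sum_star_sum)
  qed
qed

section \<open>Integral coordinates adapted to the Laplacian\<close>

text \<open>Doubling fixes \<open>b\<close>, \<open>c\<close>, \<open>h\<close> without integer
  division. The five vertices supply the traded edges \<open>ad\<close> and \<open>ae\<close>, and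
  \<open>de\<close> as an edge that stays.\<close>

locale kneser_frame =
  fixes S :: "'a set" and p q a d e :: 'a and b c h :: int
  assumes finite_S: "finite S"
    and in_S: "p \<in> S" "q \<in> S" "a \<in> S" "d \<in> S" "e \<in> S"
    and distinct_frame: "distinct [p, q, a, d, e]"
    and b: "2 * b = (int (card S) - 3) * (int (card S) - 4)"
    and c: "2 * c = (int (card S) - 1) * (int (card S) - 4)"
    and h: "2 * h = int (card S) * (int (card S) - 3)"
begin

abbreviation L :: "('a set \<Rightarrow> int) \<Rightarrow> 'a set \<Rightarrow> int" where
  "L \<equiv> laplacian_map (kneser_graph S 2)"

definition "W = S - {p, q}"

text \<open>The edges left after both trades, each carrying one free \<open>zeta\<close>
  coordinate.\<close>

definition "E = pairs W - {{a, d}, {a, e}}"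

text \<open>On a vector with entries \<open>w i + w j - r\<close>, normalised by
  \<open>w q = 0\<close>, the triangle \<open>q\<close>, \<open>a\<close>, \<open>e\<close> returns
  \<open>r\<close>, and \<open>omega\<close> then returns \<open>w\<close>.\<close>

definition rho :: "('a set \<Rightarrow> int) \<Rightarrow> int" where
  "rho x = x {a, e} - x {q, a} - x {q, e}"

definition omega :: "('a set \<Rightarrow> int) \<Rightarrow> 'a \<Rightarrow> int" where
  "omega x i = x {q, i} + rho x"

definition zeta :: "('a set \<Rightarrow> int) \<Rightarrow> 'a set \<Rightarrow> int" where
  "zeta x A = x A - (\<Sum>i\<in>A. omega x i) + rho x"

text \<open>The weight of \<open>rho\<close> is chosen to cancel the multiple of
  \<open>total_sum S x\<close> in the star sum of \<open>L x\<close> at \<open>q\<close>.\<close>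

definition upsilon :: "('a set \<Rightarrow> int) \<Rightarrow> int" where
  "upsilon x = star_sum S x q + (int (card S) - 3) * rho x"

text \<open>The difference removes the total from the image under \<open>L\<close>, and the
  \<open>omega\<close> term then removes the star sums.\<close>

definition xi :: "('a set \<Rightarrow> int) \<Rightarrow> 'a \<Rightarrow> int" where
  "xi x i = star_sum S x i - star_sum S x q - h * omega x i"

lemma card_S: "card S \<ge> 2"
proof -
  have "card {p, q} \<le> card S" using finite_S in_S by (intro card_mono) auto
  then show ?thesis using distinct_frame by simp
qed

lemma frame_neq [simp]:
  "p \<noteq> q" "p \<noteq> a" "p \<noteq> d" "p \<noteq> e" "q \<noteq> a" "q \<noteq> d" "q \<noteq> e" "a \<noteq> d" "a \<noteq> e" "d \<noteq> e"
  "q \<noteq> p" "a \<noteq> p" "d \<noteq> p" "e \<noteq> p" "a \<noteq> q" "d \<noteq> q" "e \<noteq> q" "d \<noteq> a" "e \<noteq> a" "e \<noteq> d"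
  using distinct_frame by auto

lemma in_W [simp]: "a \<in> W" "d \<in> W" "e \<in> W" "q \<notin> W" "p \<notin> W"
  using in_S by (auto simp: W_def)

lemma S_eq: "S = insert p (insert q W)"
  using in_S by (auto simp: W_def)

lemma finite_W: "finite W" and finite_E: "finite E"
  using finite_S by (auto simp: W_def E_def finite_pairs)

section \<open>The Laplacian in the adapted coordinates\<close>

lemma L_pair:
  assumes "i \<in> S" "j \<in> S" "i \<noteq> j"
  shows "L x {i, j} = c * x {i, j} + star_sum S x i + star_sum S x j - total_sum S x"
  using laplacian_map_kneser_graph[OF finite_S card_S c assms] .

lemma star_sum_L:
  assumes "i \<in> S"
  shows "star_sum S (L x) i = h * star_sum S x i - (int (card S) - 3) * total_sum S x"
proof -
  have card: "int (card (S - {i})) = int (card S) - 1"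
    using assms finite_S card_S by (simp add: of_nat_diff)
  have "star_sum S (L x) i =
      (\<Sum>j\<in>S - {i}. c * x {i, j} + star_sum S x i + star_sum S x j - total_sum S x)"
    unfolding star_sum_def[of S "L x"] using assms by (intro sum.cong refl L_pair) auto
  also have "\<dots> = c * star_sum S x i + (int (card S) - 1) * star_sum S x i +
      (2 * total_sum S x - star_sum S x i) - (int (card S) - 1) * total_sum S x"
    using assms finite_S card
    by (simp add: sum.distrib sum_subtractf sum_distrib_left[symmetric] sum_diff1 sum_star_sum
        star_sum_def[of S x i])
  also have "\<dots> = (c + int (card S) - 2) * star_sum S x i - (int (card S) - 3) * total_sum S x"
    by (simp add: algebra_simps)
  also have "c + int (card S) - 2 = h" using c h by (simp add: algebra_simps)
  finally show ?thesis .
qed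

lemma total_sum_L: "total_sum S (L x) = 0"
proof -
  have "2 * total_sum S (L x) = (\<Sum>i\<in>S. star_sum S (L x) i)"
    using finite_S by (simp add: sum_star_sum)
  also have "\<dots> = h * (2 * total_sum S x) - int (card S) * (int (card S) - 3) * total_sum S x"
    using finite_S
    by (simp add: star_sum_L sum_subtractf sum_distrib_left[symmetric] sum_star_sum)
  also have "\<dots> = 0" by (simp flip: h)
  finally show ?thesis by simp
qed

lemma rho_L: "rho (L x) = c * rho x + total_sum S x - 2 * star_sum S x q"
  using in_S by (simp add: rho_def L_pair algebra_simps)

lemma omega_L: "i \<in> W \<Longrightarrow> omega (L x) i = c * omega x i + star_sum S x i - star_sum S x q"
  using in_S by (auto simp: omega_def L_pair rho_L W_def algebra_simps)

text \<open>The part \<open>y\<^sub>i + y\<^sub>j - t\<close> of \<open>L x\<close> has the form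
  \<open>w i + w j - r\<close>, on which \<open>zeta\<close> vanishes; only \<open>c * x\<close>
  contributes.\<close>

lemma zeta_L:
  assumes "A \<in> pairs W"
  shows "zeta (L x) A = c * zeta x A"
proof -
  obtain i j where "A = {i, j}" "i \<noteq> j" "i \<in> W" "j \<in> W" using assms by (rule pairsE)
  then show ?thesis
    by (simp add: zeta_def omega_L rho_L) (simp add: L_pair W_def algebra_simps)
qed

lemma upsilon_L: "upsilon (L x) = b * star_sum S x q + c * (int (card S) - 3) * rho x"
proof -
  have "h - 2 * (int (card S) - 3) = b" using b h by (simp add: algebra_simps)
  then show ?thesis
    using in_S by (simp add: upsilon_def star_sum_L rho_L algebra_simps flip: \<open>_ = b\<close>)
qed

lemma xi_L: "i \<in> W \<Longrightarrow> xi (L x) i = - (h * c) * omega x i"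
  using in_S by (auto simp: xi_def star_sum_L omega_L W_def algebra_simps)

section \<open>The coordinates as an integral basis\<close>

text \<open>Undoing the trades: \<open>omega\<close> and \<open>rho\<close> give the edges from
  \<open>q\<close> to \<open>W\<close>, \<open>rho\<close> then gives \<open>ae\<close>, and
  \<open>zeta\<close> gives \<open>E\<close>. The star sums and the total recover \<open>ad\<close>
  and the star at \<open>p\<close>.\<close>

lemma vector_eqI:
  assumes "rho x = rho y" "\<And>i. i \<in> W \<Longrightarrow> omega x i = omega y i"
    and "\<And>A. A \<in> E \<Longrightarrow> zeta x A = zeta y A"
    and "\<And>i. i \<in> insert q W \<Longrightarrow> star_sum S x i = star_sum S y i"
    and "total_sum S x = total_sum S y" "A \<in> pairs S"
  shows "x A = y A"
proof (rule pairs_vector_eqI[of "insert q W" p a d])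
  have q: "x {q, i} = y {q, i}" if "i \<in> W" for i
    using assms(1,2) that by (simp add: omega_def)
  fix B assume B: "B \<in> pairs (insert q W) - {{a, d}}"
  consider i where "i \<in> W" "B = {q, i}" | "B = {a, e}" | "B \<in> E"
    using B by (auto simp: pairs_insert E_def)
  then show "x B = y B"
  proof cases
    case 1
    then show ?thesis using q by simp
  next
    case 2
    then show ?thesis using assms(1) q[of a] q[of e] by (simp add: rho_def)
  next
    case 3
    then have "(\<Sum>i\<in>B. omega x i) = (\<Sum>i\<in>B. omega y i)"
      using assms(2) by (intro sum.cong) (auto simp: E_def pairs_def)
    then show ?thesis using assms(1) assms(3)[OF 3] by (simp add: zeta_def)
  qed
qed (use assms S_eq finite_W in auto)

lemma vector_exists:
  fixes z :: "'a set \<Rightarrow> int"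
  obtains x where "rho x = r" "\<And>i. i \<in> W \<Longrightarrow> omega x i = w i"
    and "\<And>A. A \<in> E \<Longrightarrow> zeta x A = z A"
    and "\<And>i. i \<in> insert q W \<Longrightarrow> star_sum S x i = s i"
    and "total_sum S x = t"
proof -
  \<comment> \<open>Removing \<open>q\<close> from an edge encodes \<open>w q = 0\<close>. At
    \<open>{a, e}\<close> the residue is 0, since \<open>rho\<close> already determines that
    entry.\<close>
  define z' where "z' = (\<lambda>A. (\<Sum>i\<in>A - {q}. w i) - r + (if q \<in> A \<or> A = {a, e} then 0 else z A))"
  obtain x where x: "\<And>A. A \<in> pairs (insert q W) - {{a, d}} \<Longrightarrow> x A = z' A"
    and star: "\<And>i. i \<in> insert q W \<Longrightarrow> star_sum S x i = s i" and tot: "total_sum S x = t"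
    using pairs_vector_exists[of "insert q W" p a d z' s t] finite_W by (auto simp flip: S_eq)
  have xq: "x {q, i} = w i - r" if "i \<in> W" for i
  proof -
    have "q \<noteq> i" using that in_W by metis
    then have "x {q, i} = z' {q, i}" using that by (intro x) (auto simp: pair_in_pairs doubleton_eq_iff)
    moreover have "{q, i} - {q} = {i}" using \<open>q \<noteq> i\<close> by auto
    ultimately show ?thesis by (simp add: z'_def)
  qed
  have xW: "x A = (\<Sum>i\<in>A. w i) - r + (if A = {a, e} then 0 else z A)"
    if "A \<in> pairs W" "A \<noteq> {a, d}" for A
  proof -
    have "q \<notin> A" using that by (auto simp: pairs_def)
    moreover have "x A = z' A" using that by (intro x) (auto simp: pairs_insert)
    ultimately show ?thesis by (simp add: z'_def)
  qed
  have rho: "rho x = r"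
    using xW[of "{a, e}"] by (simp add: rho_def xq pair_in_pairs doubleton_eq_iff)
  have omega: "omega x i = w i" if "i \<in> W" for i
    using that by (simp add: omega_def rho xq)
  have zeta: "zeta x A = z A" if "A \<in> E" for A
  proof -
    have A: "A \<in> pairs W" "A \<noteq> {a, d}" "A \<noteq> {a, e}" using that by (auto simp: E_def)
    then have "(\<Sum>i\<in>A. omega x i) = (\<Sum>i\<in>A. w i)"
      using omega by (intro sum.cong) (auto simp: pairs_def)
    then show ?thesis using xW A by (simp add: zeta_def rho)
  qed
  show thesis by (rule that[OF rho omega zeta star tot])
qed

text \<open>The coordinates read entries at edges of \<open>S\<close> only, so vectors may take any
  values elsewhere.\<close>

lemma coordinates_cong:
  assumes eq: "\<And>A. A \<in> pairs S \<Longrightarrow> x A = y A"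
  shows "total_sum S x = total_sum S y" "upsilon x = upsilon y"
    and "\<And>i. i \<in> W \<Longrightarrow> xi x i = xi y i" "\<And>A. A \<in> E \<Longrightarrow> zeta x A = zeta y A"
proof -
  show "total_sum S x = total_sum S y" using eq by (rule total_sum_cong)
  have star: "star_sum S x i = star_sum S y i" if "i \<in> S" for i
    using star_sum_cong[OF eq that] .
  have rho: "rho x = rho y" using in_S by (simp add: rho_def eq pair_in_pairs)
  have omega: "omega x i = omega y i" if "i \<in> W" for i
    using in_S that by (auto simp: omega_def rho eq pair_in_pairs W_def)
  show "upsilon x = upsilon y" using in_S by (simp add: upsilon_def star rho)
  show "xi x i = xi y i" if "i \<in> W" for i
    using that in_S by (simp add: xi_def star omega W_def)
  show "zeta x A = zeta y A" if "A \<in> E" for A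
  proof -
    have "A \<subseteq> W" "A \<in> pairs S" using that by (auto simp: E_def pairs_def W_def)
    moreover from this have "(\<Sum>i\<in>A. omega x i) = (\<Sum>i\<in>A. omega y i)"
      using omega by (intro sum.cong) auto
    ultimately show ?thesis by (simp add: zeta_def rho eq)
  qed
qed

text \<open>One direction reads off the triangular formulas, the other solves them.
  \<open>rho\<close> and \<open>omega\<close> of the image can be prescribed freely, because the
  total and the star sums of \<open>y\<close> enter them with coefficient 1.\<close>

lemma in_range_L_iff:
  "(\<exists>y. \<forall>A\<in>pairs S. x A = L y A) \<longleftrightarrow>
    total_sum S x = 0 \<and> b dvd upsilon x \<and> (\<forall>i\<in>W. h * c dvd xi x i) \<and> (\<forall>A\<in>E. c dvd zeta x A)"
  (is "?lhs \<longleftrightarrow> ?rhs")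
proof
  assume ?lhs
  then obtain y where y: "\<And>A. A \<in> pairs S \<Longrightarrow> x A = L y A" by blast
  note coords = coordinates_cong[of x "L y", OF y]
  have "total_sum S x = 0" by (simp add: coords total_sum_L)
  moreover have "b dvd upsilon x"
  proof -
    \<comment> \<open>Both sides are \<open>(n-1)(n-3)(n-4)\<close>; thus the coefficient of
      \<open>rho\<close> in \<open>upsilon_L\<close> is also a multiple of \<open>b\<close>.\<close>
    have "2 * (c * (int (card S) - 3)) = 2 * (b * (int (card S) - 1))"
      using b c by (simp only: mult.assoc[symmetric]) (simp add: algebra_simps)
    then have "upsilon (L y) = b * (star_sum S y q + (int (card S) - 1) * rho y)"
      by (simp add: upsilon_L distrib_left mult.assoc[symmetric])
    then show ?thesis by (simp add: coords)
  qed
  moreover have "h * c dvd xi x i" if "i \<in> W" for i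
    using that by (simp add: coords xi_L)
  moreover have "c dvd zeta x A" if "A \<in> E" for A
  proof -
    have "A \<in> pairs W" using that by (simp add: E_def)
    then show ?thesis using that by (simp add: coords zeta_L)
  qed
  ultimately show ?rhs by blast
next
  assume R: ?rhs
  then obtain k where k: "upsilon x = b * k" by (auto simp: dvd_def)
  from R obtain w where w: "\<And>i. i \<in> W \<Longrightarrow> xi x i = h * c * w i" unfolding dvd_def by metis
  from R obtain z where z: "\<And>A. A \<in> E \<Longrightarrow> zeta x A = c * z A" unfolding dvd_def by metis
  \<comment> \<open>Prescribing the coordinate \<open>rho y = 0\<close> leaves a triangular system for the others.\<close>
  obtain y where y: "rho y = 0" "\<And>i. i \<in> W \<Longrightarrow> omega y i = - w i"
    "\<And>A. A \<in> E \<Longrightarrow> zeta y A = z A"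
    and star: "\<And>i. i \<in> insert q W \<Longrightarrow>
      star_sum S y i = (if i = q then k else omega x i + c * w i + k)"
    and tot: "total_sum S y = rho x + 2 * k"
    using vector_exists[of 0 "\<lambda>i. - w i" z
        "\<lambda>i. if i = q then k else omega x i + c * w i + k" "rho x + 2 * k"] by metis
  \<comment> \<open>With \<open>rho y = 0\<close>, the star sum \<open>k\<close> at \<open>q\<close>
    yields \<open>b * k\<close>. The total was set so that subtracting \<open>2 * k\<close> leaves
    \<open>rho x\<close>, and the summand \<open>c * w i\<close> offsets
    \<open>omega y i = - w i\<close>.\<close>
  have q: "star_sum S y q = k" using star by simp
  have ups: "upsilon x = upsilon (L y)" by (simp add: k upsilon_L q y(1))
  have rho: "rho x = rho (L y)" by (simp add: rho_L q tot y(1))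
  have neq: "i \<noteq> q" if "i \<in> W" for i using that in_W by metis
  have omega: "omega x i = omega (L y) i" if "i \<in> W" for i
    using that star[of i] neq by (simp add: omega_L q y(2))
  have xi: "xi x i = xi (L y) i" if "i \<in> W" for i
    using that by (simp add: xi_L y(2) w)
  have zeta: "zeta x A = zeta (L y) A" if "A \<in> E" for A
    using that by (simp add: z zeta_L y(3) E_def)
  \<comment> \<open>Once \<open>rho\<close> agrees, \<open>upsilon\<close> returns the star sum at
    \<open>q\<close>; \<open>xi\<close> and \<open>omega\<close> then return the others.\<close>
  have starq: "star_sum S x q = star_sum S (L y) q" using ups rho by (simp add: upsilon_def)
  have "star_sum S x i = star_sum S (L y) i" if "i \<in> insert q W" for i
    using that xi[of i] omega[of i] starq by (auto simp: xi_def)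
  then have "x A = L y A" if "A \<in> pairs S" for A
    using vector_eqI[OF rho omega zeta _ _ that] R total_sum_L by simp
  then show ?lhs by blast
qed

text \<open>With \<open>rho\<close> and \<open>omega\<close> zero, \<open>upsilon\<close> and
  \<open>xi\<close> reduce to the star sum at \<open>q\<close> and to differences from it, which are
  free.\<close>

lemma vector_exists':
  obtains x where "total_sum S x = 0" "upsilon x = u" "\<And>i. i \<in> W \<Longrightarrow> xi x i = f i"
    and "\<And>A. A \<in> E \<Longrightarrow> zeta x A = z A"
proof -
  obtain x where x: "rho x = 0" "\<And>i. i \<in> W \<Longrightarrow> omega x i = 0"
    "\<And>A. A \<in> E \<Longrightarrow> zeta x A = z A"
    "\<And>i. i \<in> insert q W \<Longrightarrow> star_sum S x i = (if i = q then u else f i + u)"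
    "total_sum S x = 0"
    using vector_exists[of 0 "\<lambda>_. 0" z "\<lambda>i. if i = q then u else f i + u" 0] by metis
  have "i \<noteq> q" if "i \<in> W" for i using that in_W by metis
  then show thesis using x by (intro that[of x]) (auto simp: upsilon_def xi_def)
qed

end

section \<open>Torsion of a quotient of an abelian group\<close>

text \<open>The torsion of \<open>A Mod N\<close> consists of the classes of the kernel of
  \<open>t\<close>: the order of \<open>H\<close> annihilates \<open>f x\<close>, while a nonzero
  \<open>t x\<close> survives every positive multiple. On that kernel \<open>f\<close> is onto
  \<open>H\<close> with kernel \<open>N\<close>.\<close>

lemma critical_part_iso:
  assumes A: "comm_group A" and H: "group H" "finite (carrier H)"
    and f: "f \<in> hom A H" and t: "t \<in> hom A integer_group"
    and N: "subgroup N A"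
    and mem_N: "\<And>x. x \<in> carrier A \<Longrightarrow> x \<in> N \<longleftrightarrow> f x = \<one>\<^bsub>H\<^esub> \<and> t x = 0"
    and surj: "\<And>y. y \<in> carrier H \<Longrightarrow> \<exists>x\<in>carrier A. f x = y \<and> t x = 0"
  shows "(A Mod N)\<lparr>carrier := torsion_elements (A Mod N)\<rparr> \<cong> H"
proof -
  interpret A: comm_group A by (rule A)
  interpret H: group H by (rule H)
  interpret N: normal N A using A.subgroup_imp_normal[OF N] .
  interpret f: group_hom A H f using f by unfold_locales
  interpret t: group_hom A integer_group t using t A.is_group group_integer_group by (simp add: group_hom_def group_hom_axioms_def)
  define K where "K = kernel A integer_group t"
  define AK where "AK = A\<lparr>carrier := K\<rparr>"
  have K: "K = {x \<in> carrier A. t x = 0}" by (auto simp: K_def kernel_def)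
  have "subgroup K A" unfolding K_def by (rule t.subgroup_kernel)
  then have "group AK" unfolding AK_def using A.is_group by (rule subgroup.subgroup_is_group)
  then interpret g: group_hom AK H f
    using f by (auto simp: group_hom_def group_hom_axioms_def H AK_def hom_def K)
  have "f ` carrier AK = carrier H"
    using surj f by (auto simp: AK_def K hom_def image_iff)
  then have "AK Mod kernel AK H f \<cong> H" by (rule g.FactGroup_iso)
  moreover have "kernel AK H f = N"
    using mem_N N.subset by (auto simp: kernel_def AK_def K)
  moreover have "AK Mod N = (A Mod N)\<lparr>carrier := torsion_elements (A Mod N)\<rparr>"
  proof -
    interpret r: group_hom A "A Mod N" "\<lambda>x. N #>\<^bsub>A\<^esub> x"
      using A.is_group N.r_coset_hom_Mod N.factorgroup_is_group
      by (simp add: group_hom_def group_hom_axioms_def)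
    have pow: "(N #>\<^bsub>A\<^esub> x) [^]\<^bsub>A Mod N\<^esub> m = N #>\<^bsub>A\<^esub> (x [^]\<^bsub>A\<^esub> m)" if "x \<in> carrier A" for x and m :: nat
      using r.hom_nat_pow[OF that] by simp
    have tpow: "t (x [^]\<^bsub>A\<^esub> m) = int m * t x" if "x \<in> carrier A" for x and m :: nat
      using t.hom_nat_pow[OF that] by simp
    have one: "N #>\<^bsub>A\<^esub> x = N \<longleftrightarrow> x \<in> N" if "x \<in> carrier A" for x
      using A.coset_join1[of N x] A.coset_join2[of x N] N that N.subset by auto
    have "N #>\<^bsub>A\<^esub> x \<in> torsion_elements (A Mod N) \<longleftrightarrow> x \<in> K" if x: "x \<in> carrier A" for x
    proof -
      have "N #>\<^bsub>A\<^esub> x \<in> torsion_elements (A Mod N) \<longleftrightarrow> (\<exists>m::nat. 0 < m \<and> x [^]\<^bsub>A\<^esub> m \<in> N)"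
        using x r.hom_closed[OF x] one by (simp add: torsion_elements_def pow)
      also have "\<dots> \<longleftrightarrow> (\<exists>m::nat. 0 < m \<and> f x [^]\<^bsub>H\<^esub> m = \<one>\<^bsub>H\<^esub> \<and> t x = 0)"
        using x by (auto simp: mem_N f.hom_nat_pow tpow)
      also have "\<dots> \<longleftrightarrow> t x = 0"
        using H.pow_order_eq_1[OF f.hom_closed[OF x]] H.order_gt_0_iff_finite H(2) by blast
      finally show ?thesis using x by (simp add: K)
    qed
    moreover have "torsion_elements (A Mod N) \<subseteq> rcosets\<^bsub>A\<^esub> N"
      by (auto simp: torsion_elements_def FactGroup_def)
    ultimately have "torsion_elements (A Mod N) = (\<Union>x\<in>K. {N #>\<^bsub>A\<^esub> x})"
      unfolding RCOSETS_def using K by blast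
    moreover have "rcosets\<^bsub>AK\<^esub> N = (\<Union>x\<in>K. {N #>\<^bsub>A\<^esub> x})"
      by (simp add: RCOSETS_def AK_def r_coset_def)
    moreover have "set_mult AK = set_mult A" by (intro ext) (simp add: AK_def set_mult_def)
    ultimately show ?thesis by (simp add: FactGroup_def)
  qed
  ultimately show ?thesis by simp
qed

section \<open>Homomorphisms into sums of cyclic groups\<close>

lemma mod_hom_integer_mod_group:
  assumes "m > 0" "\<And>x y. x \<in> carrier A \<Longrightarrow> y \<in> carrier A \<Longrightarrow> f (x \<otimes>\<^bsub>A\<^esub> y) = f x + f y"
  shows "(\<lambda>x. f x mod int m) \<in> hom A (integer_mod_group m)"
  using assms by (auto simp: hom_def carrier_integer_mod_group mod_add_eq)

lemma group_direct_power: "group G \<Longrightarrow> group (direct_power G k)"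
  by (simp add: direct_power_def)

lemma carrier_direct_power: "group G \<Longrightarrow> carrier (direct_power G k) = (\<Pi>\<^sub>E i\<in>{..<k}. carrier G)"
  by (simp add: direct_power_def carrier_sum_group)

lemma one_direct_power: "\<one>\<^bsub>direct_power G k\<^esub> = (\<lambda>i\<in>{..<k}. \<one>\<^bsub>G\<^esub>)"
  by (simp add: direct_power_def)

lemma hom_direct_power:
  assumes "group G" "\<And>i. i < k \<Longrightarrow> f i \<in> hom A G"
  shows "(\<lambda>x. \<lambda>i\<in>{..<k}. f i x) \<in> hom A (direct_power G k)"
  using assms by (auto simp: hom_def carrier_direct_power split: if_splits) (auto simp: direct_power_def)

lemma finite_integer_mod_group: "m > 0 \<Longrightarrow> finite (carrier (integer_mod_group m))"
  by (simp add: carrier_integer_mod_group)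

lemma finite_direct_power: "group G \<Longrightarrow> finite (carrier G) \<Longrightarrow> finite (carrier (direct_power G k))"
  by (simp add: carrier_direct_power finite_PiE)

section \<open>The critical group\<close>

lemma restrict_lessThan_eq_iff:
  "restrict f {..<k} = restrict g {..<k} \<longleftrightarrow> (\<forall>i<k. f i = g i)" for k :: nat
  by (auto simp: restrict_def fun_eq_iff)

lemma ball_bij_betw_iff:
  assumes "bij_betw f {..<k} A"
  shows "(\<forall>x\<in>A. P x) \<longleftrightarrow> (\<forall>i<k. P (f i))"
  using bij_betw_imp_surj_on[OF assms] by blast

text \<open>The Bezout identity makes \<open>g\<close> the gcd of \<open>b\<close> and
  \<open>c\<close>, and \<open>g * \<alpha> * \<beta>\<close> their lcm. They arise from pairing
  \<open>upsilon\<close> with the coordinate at \<open>{d, e}\<close>; the other edges in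
  \<open>E\<close> give the summands of order \<open>c\<close>.\<close>

lemma (in kneser_frame) critical_group_iso:
  fixes g \<alpha> \<beta> nc nh nb :: nat and r s :: int
  assumes "g > 0" "\<alpha> > 0" "\<beta> > 0" "nh > 0" "nc > 0"
    and c_eq: "c = int nc" "c = int g * int \<alpha>" and b_eq: "b = int g * int \<beta>" and h_eq: "h * c = int nh"
    and bezout: "s * int \<alpha> + r * int \<beta> = 1"
  shows "critical_group (kneser_graph S 2) \<cong>
    integer_mod_group g
    \<times>\<times> direct_power (integer_mod_group nc) (card E - 1)
    \<times>\<times> integer_mod_group (g * \<alpha> * \<beta>)
    \<times>\<times> direct_power (integer_mod_group nh) (card W)" (is "_ \<cong> ?H")
proof -
  let ?A = "int_vectors (pairs S)"
  let ?R = "E - {{d, e}}"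
  have deE: "{d, e} \<in> E" by (simp add: E_def pair_in_pairs doubleton_eq_iff)
  then have "card ?R = card E - 1" by simp
  then obtain ev where ev: "bij_betw ev {..<card E - 1} ?R"
    using ex_bij_betw_nat_finite[of ?R] finite_E by (auto simp: atLeast0LessThan)
  obtain ew where ew: "bij_betw ew {..<card W} W"
    using ex_bij_betw_nat_finite[OF finite_W] by (auto simp: atLeast0LessThan)
  have evR: "ev i \<in> ?R" if "i < card E - 1" for i using bij_betwE[OF ev] that by auto
  have ewW: "ew i \<in> W" if "i < card W" for i using bij_betwE[OF ew] that by auto
  \<comment> \<open>The Bezout identity makes \<open>(p1, p2)\<close>, divided by the moduli \<open>(g, g * \<alpha> * \<beta>)\<close>, a unimodular
    transform of the pair \<open>(upsilon, zeta de)\<close> divided by \<open>(b, c)\<close>.\<close>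
  define p1 where "p1 x = zeta x {d, e} - upsilon x" for x
  define p2 where "p2 x = int \<alpha> * s * upsilon x + int \<beta> * r * zeta x {d, e}" for x
  define F where "F = (\<lambda>x. (p1 x mod int g, (\<lambda>i\<in>{..<card E - 1}. zeta x (ev i) mod int nc),
    p2 x mod int (g * \<alpha> * \<beta>), (\<lambda>i\<in>{..<card W}. xi x (ew i) mod int nh)))"
  have carrier: "carrier ?A = (\<Pi>\<^sub>E A\<in>pairs S. UNIV)" by (simp add: int_vectors_def)
  have add: "(x \<otimes>\<^bsub>?A\<^esub> y) A = x A + y A" if "A \<in> pairs S" for x y A
    using that by (simp add: int_vectors_def)
  have total_add: "total_sum S (x \<otimes>\<^bsub>?A\<^esub> y) = total_sum S x + total_sum S y" for x y
    by (simp add: total_sum_def add sum.distrib)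
  have star_add: "star_sum S (x \<otimes>\<^bsub>?A\<^esub> y) i = star_sum S x i + star_sum S y i" if "i \<in> S" for x y i
    unfolding star_sum_def sum.distrib[symmetric]
    using that by (intro sum.cong refl add) (auto simp: pair_in_pairs)
  have rho_add: "rho (x \<otimes>\<^bsub>?A\<^esub> y) = rho x + rho y" for x y
    using in_S by (simp add: rho_def add pair_in_pairs)
  have omega_add: "omega (x \<otimes>\<^bsub>?A\<^esub> y) i = omega x i + omega y i" if "i \<in> W" for x y i
    using in_S that by (auto simp: omega_def add pair_in_pairs rho_add W_def)
  have zeta_add: "zeta (x \<otimes>\<^bsub>?A\<^esub> y) A = zeta x A + zeta y A" if "A \<in> E" for x y A
  proof -
    have "A \<subseteq> W" "A \<in> pairs S" using that by (auto simp: E_def pairs_def W_def)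
    then have "(\<Sum>i\<in>A. omega (x \<otimes>\<^bsub>?A\<^esub> y) i) = (\<Sum>i\<in>A. omega x i + omega y i)"
      using omega_add by (intro sum.cong) auto
    then show ?thesis using \<open>A \<in> pairs S\<close> by (simp add: zeta_def add rho_add sum.distrib)
  qed
  have upsilon_add: "upsilon (x \<otimes>\<^bsub>?A\<^esub> y) = upsilon x + upsilon y" for x y
    using in_S by (simp add: upsilon_def star_add rho_add algebra_simps)
  have xi_add: "xi (x \<otimes>\<^bsub>?A\<^esub> y) i = xi x i + xi y i" if "i \<in> W" for x y i
    using that in_S by (simp add: xi_def star_add omega_add W_def algebra_simps)
  have "(laplacian_cokernel (kneser_graph S 2))\<lparr>carrier := torsion_elements (laplacian_cokernel (kneser_graph S 2))\<rparr> \<cong> ?H"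
    unfolding laplacian_cokernel_def pverts_kneser_graph
  proof (rule critical_part_iso[where f = F and t = "total_sum S"])
    show "comm_group ?A" by (rule comm_group_int_vectors)
    show "group ?H" by (intro DirProd_group group_direct_power group_integer_mod_group)
    show "finite (carrier ?H)"
      using assms(1-5) by (simp add: finite_integer_mod_group finite_direct_power)
    show "F \<in> hom ?A ?H"
      unfolding F_def hom_paired using assms(1-5) evR ewW
      by (intro conjI mod_hom_integer_mod_group hom_direct_power group_integer_mod_group)
        (simp_all add: p1_def p2_def zeta_add upsilon_add xi_add deE distrib_left)
    show "total_sum S \<in> hom ?A integer_group"
      by (simp add: hom_def total_add)
    show "subgroup (L ` carrier ?A) ?A"
      using subgroup_laplacian_image[of "kneser_graph S 2"] by (simp add: pverts_kneser_graph)
  next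
    fix x assume x: "x \<in> carrier ?A"
    have L_carrier: "L y \<in> carrier ?A" for y by (simp add: carrier laplacian_map_def pverts_kneser_graph)
    \<comment> \<open>\<open>L\<close> reads only entries in \<open>pairs S\<close>, so its image on
      the carrier equals its image on all functions.\<close>
    have L_restrict: "L y = L (restrict y (pairs S))" for y
      unfolding laplacian_map_def pverts_kneser_graph by (intro restrict_ext sum.cong) auto
    have "restrict y (pairs S) \<in> carrier ?A" for y by (simp add: carrier)
    then have "L y \<in> L ` carrier ?A" for y by (subst L_restrict) (rule imageI)
    then have "x \<in> L ` carrier ?A \<longleftrightarrow> (\<exists>y. x = L y)" by auto
    also have "\<dots> \<longleftrightarrow> (\<exists>y. \<forall>A\<in>pairs S. x A = L y A)"
    proof (rule ex_cong1)
      show "x = L y \<longleftrightarrow> (\<forall>A\<in>pairs S. x A = L y A)" for y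
        using PiE_ext[OF x[unfolded carrier] L_carrier[unfolded carrier, of y]] by metis
    qed
    also have "\<dots> \<longleftrightarrow> F x = \<one>\<^bsub>?H\<^esub> \<and> total_sum S x = 0"
    proof -
      have "(\<forall>i\<in>W. h * c dvd xi x i) \<longleftrightarrow> (\<forall>i<card W. int nh dvd xi x (ew i))"
        unfolding h_eq by (rule ball_bij_betw_iff[OF ew])
      moreover have "(\<forall>A\<in>E. c dvd zeta x A) \<longleftrightarrow>
          c dvd zeta x {d, e} \<and> (\<forall>A\<in>?R. c dvd zeta x A)" using deE by auto
      moreover have "(\<forall>A\<in>?R. c dvd zeta x A) \<longleftrightarrow> (\<forall>i<card E - 1. int nc dvd zeta x (ev i))"
        unfolding c_eq(1) by (rule ball_bij_betw_iff[OF ev])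
      moreover have "b dvd upsilon x \<and> c dvd zeta x {d, e} \<longleftrightarrow>
          int g dvd p1 x \<and> int (g * \<alpha> * \<beta>) dvd p2 x"
      proof
        assume "b dvd upsilon x \<and> c dvd zeta x {d, e}"
        then obtain k l where "upsilon x = int g * int \<beta> * k" "zeta x {d, e} = int g * int \<alpha> * l"
          unfolding b_eq c_eq(2) by (elim conjE dvdE)
        then have "p1 x = int g * (int \<alpha> * l - int \<beta> * k)"
          and "p2 x = int (g * \<alpha> * \<beta>) * (s * k + r * l)"
          by (simp_all add: p1_def p2_def algebra_simps)
        then show "int g dvd p1 x \<and> int (g * \<alpha> * \<beta>) dvd p2 x"
          by (simp only: dvd_triv_left)
      next
        assume "int g dvd p1 x \<and> int (g * \<alpha> * \<beta>) dvd p2 x"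
        then obtain k l where kl: "p1 x = int g * k" "p2 x = int (g * \<alpha> * \<beta>) * l"
          by (elim conjE dvdE)
        \<comment> \<open>Eliminating \<open>zeta x {d, e}\<close>, and further down
          \<open>upsilon x\<close>, from \<open>p1\<close> and \<open>p2\<close> leaves the Bezout
          sum as coefficient.\<close>
        have "(s * int \<alpha> + r * int \<beta>) * upsilon x = p2 x - int \<beta> * r * p1 x"
          by (simp add: p1_def p2_def algebra_simps)
        also have "\<dots> = int g * int \<beta> * (int \<alpha> * l - r * k)" by (simp add: kl algebra_simps)
        finally have "upsilon x = int g * int \<beta> * (int \<alpha> * l - r * k)" by (simp add: bezout)
        moreover have "(s * int \<alpha> + r * int \<beta>) * zeta x {d, e} = p2 x + int \<alpha> * s * p1 x"
          by (simp add: p1_def p2_def algebra_simps)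
        then have "zeta x {d, e} = p2 x + int \<alpha> * s * p1 x" by (simp add: bezout)
        then have "zeta x {d, e} = int g * int \<alpha> * (int \<beta> * l + s * k)"
          by (simp add: kl algebra_simps)
        ultimately show "b dvd upsilon x \<and> c dvd zeta x {d, e}"
          unfolding b_eq c_eq(2) by (simp only: dvd_triv_left)
      qed
      moreover have "F x = \<one>\<^bsub>?H\<^esub> \<longleftrightarrow> int g dvd p1 x \<and> (\<forall>i<card E - 1. int nc dvd zeta x (ev i)) \<and>
          int (g * \<alpha> * \<beta>) dvd p2 x \<and> (\<forall>i<card W. int nh dvd xi x (ew i))"
        by (simp add: F_def one_direct_power restrict_lessThan_eq_iff mod_eq_0_iff_dvd)
      ultimately show ?thesis
        unfolding in_range_L_iff
        by argo
    qed
    finally show "x \<in> L ` carrier ?A \<longleftrightarrow> F x = \<one>\<^bsub>?H\<^esub> \<and> total_sum S x = 0" .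
  next
    fix y assume "y \<in> carrier ?H"
    then obtain y1 y2 y3 y4 where y: "y = (y1, y2, y3, y4)"
      and y1: "y1 mod int g = y1" and y3: "y3 mod int (g * \<alpha> * \<beta>) = y3"
      and y2: "y2 \<in> (\<Pi>\<^sub>E i\<in>{..<card E - 1}. {0..<int nc})"
      and y4: "y4 \<in> (\<Pi>\<^sub>E i\<in>{..<card W}. {0..<int nh})"
      using assms(1-5) by (auto simp: carrier_direct_power carrier_integer_mod_group)
    \<comment> \<open>The inverse of the unimodular transform supplies the value at
      \<open>{d, e}\<close> and that of \<open>upsilon\<close>; elsewhere the enumerations are
      inverted.\<close>
    define z where "z = (\<lambda>A. if A = {d, e} then y3 + int \<alpha> * s * y1
      else y2 (inv_into {..<card E - 1} ev A))"
    obtain x where x: "total_sum S x = 0" "upsilon x = y3 - int \<beta> * r * y1"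
      "\<And>i. i \<in> W \<Longrightarrow> xi x i = y4 (inv_into {..<card W} ew i)"
      "\<And>A. A \<in> E \<Longrightarrow> zeta x A = z A"
      using vector_exists'[where u = "y3 - int \<beta> * r * y1" and z = z
          and f = "\<lambda>i. y4 (inv_into {..<card W} ew i)"] by metis
    have de: "zeta x {d, e} = y3 + int \<alpha> * s * y1" using x(4) deE by (simp add: z_def)
    have "p1 x = (s * int \<alpha> + r * int \<beta>) * y1"
      by (simp add: p1_def de x(2) algebra_simps)
    then have "p1 x = y1" by (simp add: bezout)
    moreover have "p2 x = (s * int \<alpha> + r * int \<beta>) * y3"
      by (simp add: p2_def de x(2) algebra_simps)
    then have "p2 x = y3" by (simp add: bezout)
    moreover have "zeta x (ev i) = y2 i" if "i < card E - 1" for i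
      using evR[OF that] that bij_betw_inv_into_left[OF ev] by (simp add: x(4) z_def)
    moreover have "xi x (ew i) = y4 i" if "i < card W" for i
      using ewW[OF that] that bij_betw_inv_into_left[OF ew] by (simp add: x(3))
    ultimately have "F x = y"
      using y2 y4 y1 y3 unfolding F_def y by (auto simp: PiE_iff extensional_def fun_eq_iff)
    \<comment> \<open>Restriction moves the witness into the carrier and keeps its
      coordinates.\<close>
    have "restrict x (pairs S) A = x A" if "A \<in> pairs S" for A using that by simp
    note coords = coordinates_cong[of "restrict x (pairs S)" x, OF this]
    have "F (restrict x (pairs S)) = F x"
      using evR ewW deE by (auto simp: F_def p1_def p2_def coords)
    then show "\<exists>x\<in>carrier ?A. F x = y \<and> total_sum S x = 0"
      using \<open>F x = y\<close> x(1) unfolding carrier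
      by (intro bexI[of _ "restrict x (pairs S)"]) (auto simp: coords)
  qed
  then show ?thesis by (simp add: critical_group_def)
qed

section \<open>Choice of the frame, counting, and the two parities\<close>

lemma obtain_five_elements:
  assumes "finite S" "card S \<ge> 5"
  obtains p q a d e where "p \<in> S" "q \<in> S" "a \<in> S" "d \<in> S" "e \<in> S" "distinct [p, q, a, d, e]"
proof -
  obtain xs where xs: "set xs = S" "distinct xs" using assms(1) finite_distinct_list by blast
  then have "length xs \<ge> Suc (Suc (Suc (Suc (Suc 0))))" using assms(2) distinct_card by fastforce
  then obtain p q a d e ys where "xs = p # q # a # d # e # ys" by (auto simp: Suc_le_length_iff)
  then show thesis using xs by (intro that[of p q a d e]) auto
qed

lemma (in kneser_frame) card_W: "card W = card S - 2"
  using in_S finite_S by (simp add: W_def card_Diff_subset)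

text \<open>Three edges inside \<open>W\<close> drop out: \<open>ad\<close> and \<open>ae\<close>,
  which are traded, and \<open>de\<close>, which is paired with \<open>upsilon\<close>.\<close>

lemma (in kneser_frame) card_E: "card E - 1 = card S * (card S - 5) div 2"
proof -
  have "card {p, q, a, d, e} \<le> card S" using finite_S in_S by (intro card_mono) auto
  then obtain m where m: "card S = m + 5" using le_Suc_ex[of 5 "card S"] by (auto simp: add.commute)
  have "card E = (card W choose 2) - 2"
    using finite_W
    by (simp add: E_def card_Diff_subset card_pairs pair_in_pairs doubleton_eq_iff)
  moreover have "card W choose 2 = m * (m + 5) div 2 + 3"
    by (simp add: card_W m choose_two algebra_simps)
  ultimately show ?thesis by (simp add: m mult.commute)
qed

theorem theorem4p1:
  fixes S :: "'a set" and n :: nat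
  assumes "finite S" and "card S = n" and "n \<ge> 5"
  shows
    "(odd n \<longrightarrow>
       critical_group (kneser_graph S 2) \<cong>
         integer_mod_group (n - 4)
         \<times>\<times> direct_power (integer_mod_group ((n - 4) * (n - 1) div 2)) (n * (n - 5) div 2)
         \<times>\<times> integer_mod_group ((n - 4) * (n - 1) * (n - 3) div 4)
         \<times>\<times> direct_power (integer_mod_group ((n - 4) * (n - 1) * (n - 3) * n div 4)) (n - 2))
     \<and>
     (even n \<longrightarrow>
       critical_group (kneser_graph S 2) \<cong>
         integer_mod_group ((n - 4) div 2)
         \<times>\<times> direct_power (integer_mod_group ((n - 4) * (n - 1) div 2)) (n * (n - 5) div 2)
         \<times>\<times> integer_mod_group ((n - 4) * (n - 1) * (n - 3) div 2)
         \<times>\<times> direct_power (integer_mod_group ((n - 4) * (n - 1) * (n - 3) * n div 4)) (n - 2))"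
proof -
  obtain p q a d e where frame: "p \<in> S" "q \<in> S" "a \<in> S" "d \<in> S" "e \<in> S" "distinct [p, q, a, d, e]"
    using obtain_five_elements assms by metis
  show ?thesis
  proof (intro conjI impI)
    assume "odd n"
    then obtain j where n: "n = 2 * j + 5"
      using assms(3) by (metis add.commute dvd_add_right_iff even_numeral le_Suc_ex odd_add odd_numeral evenE)
    \<comment> \<open>Here \<open>b\<close> and \<open>c\<close> have gcd \<open>2 * j + 1\<close>;
      the cofactors \<open>j + 1\<close> and \<open>j + 2\<close> are consecutive, whence the Bezout
      coefficients \<open>-1\<close> and \<open>1\<close>.\<close>
    interpret kneser_frame S p q a d e "int ((2 * j + 1) * (j + 1))" "int ((2 * j + 1) * (j + 2))"
        "int ((2 * j + 5) * (j + 1))"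
      using assms frame n by unfold_locales (auto simp: algebra_simps)
    have nums: "n - 4 = 2 * j + 1" "(n - 4) * (n - 1) div 2 = (2 * j + 1) * (j + 2)"
      "(n - 4) * (n - 1) * (n - 3) div 4 = (2 * j + 1) * (j + 2) * (j + 1)"
      "(n - 4) * (n - 1) * (n - 3) * n div 4 = (2 * j + 5) * (j + 1) * ((2 * j + 1) * (j + 2))"
    proof -
      have 1: "n - 4 = 2 * j + 1" "n - 1 = 2 * (j + 2)" "n - 3 = 2 * (j + 1)" using n by simp_all
      then show "n - 4 = 2 * j + 1" by simp
      have "(n - 4) * (n - 1) = 2 * ((2 * j + 1) * (j + 2))"
        "(n - 4) * (n - 1) * (n - 3) = 4 * ((2 * j + 1) * (j + 2) * (j + 1))"
        "(n - 4) * (n - 1) * (n - 3) * n = 4 * ((2 * j + 5) * (j + 1) * ((2 * j + 1) * (j + 2)))"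
        unfolding 1 n by (simp_all add: algebra_simps)
      then show "(n - 4) * (n - 1) div 2 = (2 * j + 1) * (j + 2)"
        "(n - 4) * (n - 1) * (n - 3) div 4 = (2 * j + 1) * (j + 2) * (j + 1)"
        "(n - 4) * (n - 1) * (n - 3) * n div 4 = (2 * j + 5) * (j + 1) * ((2 * j + 1) * (j + 2))"
        by (simp_all only: nonzero_mult_div_cancel_left numeral_neq_zero not_False_eq_True)
    qed
    show "critical_group (kneser_graph S 2) \<cong>
         integer_mod_group (n - 4)
         \<times>\<times> direct_power (integer_mod_group ((n - 4) * (n - 1) div 2)) (n * (n - 5) div 2)
         \<times>\<times> integer_mod_group ((n - 4) * (n - 1) * (n - 3) div 4)
         \<times>\<times> direct_power (integer_mod_group ((n - 4) * (n - 1) * (n - 3) * n div 4)) (n - 2)"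
      \<comment> \<open>The products contain \<open>n - 4\<close>, so they are rewritten before
        it.\<close>
      unfolding nums(2-4) unfolding nums(1)
      by (rule critical_group_iso[where s = 1 and r = "-1", unfolded card_E card_W assms(2)])
        (simp_all add: algebra_simps)
  next
    assume "even n"
    then obtain j where n: "n = 2 * j + 6"
    proof -
      have "n \<ge> 6" using \<open>even n\<close> assms(3) by (cases "n = 5") auto
      then obtain m where "n = 6 + m" by (auto dest: le_Suc_ex)
      moreover from this have "even m" using \<open>even n\<close> by simp
      ultimately show thesis using that by (auto elim!: evenE)
    qed
    \<comment> \<open>Now the gcd is \<open>j + 1\<close>, and the cofactors
      \<open>2 * j + 3\<close> and \<open>2 * j + 5\<close> are odd numbers differing by 2, hence
      coprime.\<close>
    interpret kneser_frame S p q a d e "int ((j + 1) * (2 * j + 3))" "int ((j + 1) * (2 * j + 5))"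
        "int ((j + 3) * (2 * j + 3))"
      using assms frame n by unfold_locales (auto simp: algebra_simps)
    have nums: "(n - 4) div 2 = j + 1" "(n - 4) * (n - 1) div 2 = (j + 1) * (2 * j + 5)"
      "(n - 4) * (n - 1) * (n - 3) div 2 = (j + 1) * (2 * j + 5) * (2 * j + 3)"
      "(n - 4) * (n - 1) * (n - 3) * n div 4 = (j + 3) * (2 * j + 3) * ((j + 1) * (2 * j + 5))"
    proof -
      have 1: "n - 4 = 2 * (j + 1)" "n - 1 = 2 * j + 5" "n - 3 = 2 * j + 3" using n by simp_all
      then show "(n - 4) div 2 = j + 1" by simp
      have "(n - 4) * (n - 1) = 2 * ((j + 1) * (2 * j + 5))"
        "(n - 4) * (n - 1) * (n - 3) = 2 * ((j + 1) * (2 * j + 5) * (2 * j + 3))"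
        "(n - 4) * (n - 1) * (n - 3) * n = 4 * ((j + 3) * (2 * j + 3) * ((j + 1) * (2 * j + 5)))"
        unfolding 1 n by (simp_all add: algebra_simps)
      then show "(n - 4) * (n - 1) div 2 = (j + 1) * (2 * j + 5)"
        "(n - 4) * (n - 1) * (n - 3) div 2 = (j + 1) * (2 * j + 5) * (2 * j + 3)"
        "(n - 4) * (n - 1) * (n - 3) * n div 4 = (j + 3) * (2 * j + 3) * ((j + 1) * (2 * j + 5))"
        by (simp_all only: nonzero_mult_div_cancel_left numeral_neq_zero not_False_eq_True)
    qed
    have "- int (j + 1) * int (2 * j + 5) + int (j + 2) * int (2 * j + 3) = 1"
      by (simp add: algebra_simps)
    then show "critical_group (kneser_graph S 2) \<cong>
         integer_mod_group ((n - 4) div 2)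
         \<times>\<times> direct_power (integer_mod_group ((n - 4) * (n - 1) div 2)) (n * (n - 5) div 2)
         \<times>\<times> integer_mod_group ((n - 4) * (n - 1) * (n - 3) div 2)
         \<times>\<times> direct_power (integer_mod_group ((n - 4) * (n - 1) * (n - 3) * n div 4)) (n - 2)"
      unfolding nums(2-4) unfolding nums(1)
      by (intro critical_group_iso[where s = "- int (j + 1)" and r = "int (j + 2)",
            unfolded card_E card_W assms(2)])
        (simp_all add: algebra_simps)
  qed
qed

end
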